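(* Let $\lambda$ be a nonzero real number. For all integers $n,k$ with $n\ge k\ge 0$, \[ {n \brace k}_{\lambda}^{*}=\sum_{m=k}^n \lambda^{m-k} {m \brace k} {n \brace m}. \]
   Context: The Stirling numbers of the second kind ${n\brace k}$ are defined by $\frac{1}{k!}(e^t-1)^k=\sum_{n=k}^\infty {n\brace k}\frac{t^n}{n!}$ for $k\ge0$. For nonzero real $\lambda$, the new type degenerate Stirling numbers of the second kind ${n\brace k}_{\lambda}^{*}$ are defined by \[ \frac{1}{k!}\left(\frac{1}{\lambda}\left(e^{\lambda(e^t-1)}-1\right)\right)^k=\sum_{n=k}^\infty {n\brace k}_{\lambda}^{*}\frac{t^n}{n!},\qquad k\ge0. \] *)

theory Defs
  imports
    "HOL-Combinatorics.Stirling"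
    "HOL-Computational_Algebra.Formal_Power_Series"
begin

text \<open>
  The Stirling numbers of the second kind are the library's \<open>Stirling\<close>, which is defined by
  recursion. The next lemma shows that it agrees with the definition by the exponential generating
  function; the coefficients at \<open>n < k\<close> are zero on both sides.
\<close>

lemma Stirling_egf:
  "fps_const (1 / fact k) * (fps_exp 1 - 1) ^ k = Abs_fps (\<lambda>n. real (Stirling n k) / fact n)"
proof -
  define f :: "nat \<Rightarrow> real fps" where "f k = fps_const (1 / fact k) * (fps_exp 1 - 1) ^ k" for k
  have f_deriv: "fps_deriv (f (Suc j)) = of_nat (Suc j) * f (Suc j) + f j" for j
  proof -
    have *: "fps_const (1 / fact j) = of_nat (Suc j) * (fps_const (1 / fact (Suc j)) :: real fps)"
      by (simp add: fps_of_nat [symmetric] field_simps del: of_nat_Suc)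
    have "fps_deriv ((fps_exp 1 - 1 :: real fps) ^ Suc j) =
        of_nat (Suc j) * fps_exp 1 * (fps_exp 1 - 1) ^ j"
      unfolding fps_deriv_power by (simp add: fps_of_nat del: of_nat_Suc power_Suc)
    then have "fps_deriv (f (Suc j)) =
        of_nat (Suc j) * fps_const (1 / fact (Suc j)) * (fps_exp 1 - 1) ^ j * ((fps_exp 1 - 1) + 1)"
      unfolding f_def by (simp only: fps_deriv_mult_const_left diff_add_cancel mult_ac)
    also have "\<dots> = of_nat (Suc j) * f (Suc j) + f j"
      unfolding f_def * by (simp only: power_Suc algebra_simps mult_1_left mult_1_right)
    finally show ?thesis .
  qed
  have "fps_nth (f k) n = real (Stirling n k) / fact n" for n k
  proof (induction n arbitrary: k)
    case 0
    show ?case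
      by (cases k) (simp_all add: f_def fps_mult_nth_0)
  next
    case (Suc n)
    show ?case
    proof (cases k)
      case 0
      then show ?thesis by (simp add: f_def)
    next
      case (Suc j)
      have "of_nat (Suc n) * fps_nth (f (Suc j)) (Suc n) = of_nat (Suc j) * fps_nth (f (Suc j)) n + fps_nth (f j) n"
        using arg_cong [OF f_deriv [of j], of "\<lambda>g. fps_nth g n"]
        by (simp add: fps_of_nat [symmetric] del: of_nat_Suc)
      then have "fact (Suc n) * fps_nth (f (Suc j)) (Suc n) = real (Stirling (Suc n) (Suc j))"
        unfolding Suc.IH by (simp add: field_simps)
      then show ?thesis
        unfolding Suc by (metis fact_nonzero nonzero_mult_div_cancel_left)
    qed
  qed
  then show ?thesis
    by (auto simp: f_def fps_eq_iff)
qed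

text \<open>
  The base of the power is the formal power series of
  \<open>(exp (lam * (exp t - 1)) - 1) / lam\<close>; the composition is the usual one because \<open>fps_exp 1 - 1\<close> has
  zero constant term.
\<close>

definition degenerate_Stirling_egf :: "real \<Rightarrow> nat \<Rightarrow> real fps" where
  "degenerate_Stirling_egf lam k =
     fps_const (1 / fact k) *
       (fps_const (1 / lam) * ((fps_exp lam oo (fps_exp 1 - 1)) - 1)) ^ k"

definition degenerate_Stirling :: "real \<Rightarrow> nat \<Rightarrow> nat \<Rightarrow> real" where
  "degenerate_Stirling lam n k = fact n * fps_nth (degenerate_Stirling_egf lam k) n"

text \<open>The series starts at \<open>t ^ k\<close>, as the defining sum over \<open>n \<ge> k\<close> presupposes.\<close>

lemma degenerate_Stirling_eq_0:
  assumes "n < k"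
  shows "degenerate_Stirling lam n k = 0"
proof -
  have "fps_nth (fps_const (1 / lam) * ((fps_exp lam oo (fps_exp 1 - 1)) - 1)) 0 = 0"
    by simp
  from startsby_zero_power_prefix [OF this] assms show ?thesis
    by (simp add: degenerate_Stirling_def degenerate_Stirling_egf_def)
qed

end

theory Submission imports Defs begin

text \<open>
  The generating function of the degenerate numbers is the composition of
  \<open>((exp (lam * u) - 1) / lam) ^ k / k!\<close> with \<open>u = exp t - 1\<close>. The outer series is a rescaling of the
  generating function of the numbers \<open>Stirling m k\<close>, while \<open>u ^ m / m!\<close> generates the numbers
  \<open>Stirling n m\<close>.
\<close>

text \<open>Replacing \<open>t\<close> by \<open>c * t\<close> in \<open>(exp t - 1) ^ k\<close>
  multiplies the coefficient of \<open>t ^ n\<close> by \<open>c ^ n\<close>.\<close>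

lemma fps_nth_exp_minus_1_power:
  "fps_nth ((fps_exp (c::real) - 1) ^ k) n = c ^ n * fact k * real (Stirling n k) / fact n"
proof -
  have unscaled: "fps_nth ((fps_exp (1::real) - 1) ^ k) n = fact k * real (Stirling n k) / fact n"
    using arg_cong [OF Stirling_egf [of k], of "\<lambda>g. fps_nth g n"] by (simp add: field_simps)
  have "(fps_exp c - 1) ^ k = (fps_exp 1 - 1) ^ k oo (fps_const c * fps_X)"
    by (simp add: fps_compose_sub_distrib flip: fps_compose_power)
  then show ?thesis
    by (simp add: fps_compose_linear unscaled)
qed

text \<open>Composition with an inner series of zero constant term respects products and
  powers.\<close>

lemma degenerate_Stirling_egf_compose:
  "degenerate_Stirling_egf lam k =
    (fps_const (1 / (fact k * lam ^ k)) * (fps_exp lam - 1) ^ k) oo (fps_exp 1 - 1)"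
  by (simp add: degenerate_Stirling_egf_def fps_compose_mult_distrib
      fps_compose_sub_distrib power_mult_distrib fps_const_power power_one_over
      flip: mult.assoc fps_compose_power)

theorem theorem3p1:
  fixes lam :: real and n k :: nat
  assumes "lam \<noteq> 0" and "k \<le> n"
  shows "degenerate_Stirling lam n k =
    (\<Sum>m=k..n. lam ^ (m - k) * real (Stirling m k) * real (Stirling n m))"
proof -
  have "degenerate_Stirling lam n k =
      (\<Sum>m=0..n. lam ^ m / lam ^ k * real (Stirling m k) * real (Stirling n m))"
    unfolding degenerate_Stirling_def degenerate_Stirling_egf_compose fps_compose_nth sum_distrib_left
    \<comment> \<open>The coefficient formula serves twice, with \<open>c = lam\<close> for the
      outer series and \<open>c = 1\<close> for the powers of the inner one; all factorials
      cancel.\<close>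
    by (intro sum.cong refl) (simp add: fps_nth_exp_minus_1_power field_simps)
  also have "\<dots> = (\<Sum>m=k..n. lam ^ m / lam ^ k * real (Stirling m k) * real (Stirling n m))"
    \<comment> \<open>\<open>Stirling m k\<close> vanishes for \<open>m < k\<close>.\<close>
    by (rule sum.mono_neutral_right) auto
  also have "\<dots> = (\<Sum>m=k..n. lam ^ (m - k) * real (Stirling m k) * real (Stirling n m))"
    using assms(1) by (intro sum.cong refl) (simp add: power_diff)
  finally show ?thesis .
qed

end
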